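(* Let $B_0\in\mathbb{R}^{n\times n}$ be symmetric and nonsingular, let $(s_0,y_0),\dots,(s_k,y_k)$ be pairs of vectors in $\mathbb{R}^n$, and let $B_1,\dots,B_{k+1}$ be obtained from $B_0$ by successive symmetric rank-one (SR1) updates, all of which are assumed well defined, with $B_{k+1}$ nonsingular. Put $H_0=B_0^{-1}$ and $H_{k+1}=B_{k+1}^{-1}$. Then $$H_{k+1}=H_0+\tilde\Psi_k\tilde M_k\tilde\Psi_k^T,$$ where $$\tilde\Psi_k=S_k-H_0Y_k\qquad\text{and}\qquad \tilde M_k=\left(D_k+R_k+R_k^T-Y_k^TH_0Y_k\right)^{-1}.$$
   Context: The SR1 update is, for $0\le i\le k$, $$B_{i+1}=B_i+\frac{1}{s_i^T(y_i-B_is_i)}(y_i-B_is_i)(y_i-B_is_i)^T.$$ It is well defined when $s_i^T(y_i-B_is_i)\ne0$. Notation: $S_k=[s_0\ s_1\ \cdots\ s_k]\in\mathbb{R}^{n\times(k+1)}$, $Y_k=[y_0\ y_1\ \cdots\ y_k]\in\mathbb{R}^{n\times(k+1)}$, and $S_k^TY_k=L_k+D_k+R_k$ with $L_k$ strictly lower triangular, $D_k$ diagonal and $R_k$ strictly upper triangular. *)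

theory Defs
  imports Complex_Main "Jordan_Normal_Form.Gauss_Jordan_Elimination"
begin

text \<open>The inverse of a matrix; it is unspecified when the matrix is not invertible.\<close>

definition mat_inv :: "'a::field mat \<Rightarrow> 'a mat" where
  "mat_inv A = the (mat_inverse A)"

lemma mat_inv:
  assumes A: "A \<in> carrier_mat n n" and inv: "invertible_mat A"
  shows "mat_inv A \<in> carrier_mat n n" "A * mat_inv A = 1\<^sub>m n" "mat_inv A * A = 1\<^sub>m n"
proof -
  obtain C where AC: "A * C = 1\<^sub>m (dim_row A)" and CA: "C * A = 1\<^sub>m (dim_row C)"
    using inv unfolding invertible_mat_def inverts_mat_def by blast
  have "dim_col C = n" using arg_cong[OF AC, of dim_col] A by simp
  moreover have "dim_row C = n" using arg_cong[OF CA, of dim_col] A by simp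
  ultimately have "C \<in> carrier_mat n n" by auto
  then have "A \<in> Units (ring_mat TYPE('a) n ())"
    using A AC CA unfolding Units_def ring_mat_def by auto
  then obtain D where "mat_inverse A = Some D"
    using mat_inverse(1)[OF A, of "()"] by (cases "mat_inverse A") auto
  then show "mat_inv A \<in> carrier_mat n n" "A * mat_inv A = 1\<^sub>m n" "mat_inv A * A = 1\<^sub>m n"
    using mat_inverse(2)[OF A] unfolding mat_inv_def by auto
qed

definition outer_prod :: "'a::times vec \<Rightarrow> 'a vec \<Rightarrow> 'a mat" where
  "outer_prod u v = mat (dim_vec u) (dim_vec v) (\<lambda>(i, j). u $ i * v $ j)"

definition sr1_well_defined :: "'a::field mat \<Rightarrow> 'a vec \<Rightarrow> 'a vec \<Rightarrow> bool" where
  "sr1_well_defined B s y \<longleftrightarrow> s \<bullet> (y - B *\<^sub>v s) \<noteq> 0"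

definition sr1_update :: "'a::field mat \<Rightarrow> 'a vec \<Rightarrow> 'a vec \<Rightarrow> 'a mat" where
  "sr1_update B s y =
     B + (1 / (s \<bullet> (y - B *\<^sub>v s))) \<cdot>\<^sub>m outer_prod (y - B *\<^sub>v s) (y - B *\<^sub>v s)"

definition strictly_lower_triangular :: "'a::zero mat \<Rightarrow> bool" where
  "strictly_lower_triangular A \<longleftrightarrow>
     (\<forall>i < dim_row A. \<forall>j < dim_col A. i \<le> j \<longrightarrow> A $$ (i, j) = 0)"

definition strictly_upper_triangular :: "'a::zero mat \<Rightarrow> bool" where
  "strictly_upper_triangular A \<longleftrightarrow>
     (\<forall>i < dim_row A. \<forall>j < dim_col A. j \<le> i \<longrightarrow> A $$ (i, j) = 0)"

end

theory Submission
  imports Defs "Jordan_Normal_Form.Determinant"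
begin

text \<open>
  With \<open>w\<^sub>i = B\<^sub>i s\<^sub>i - y\<^sub>i\<close> and \<open>e\<^sub>i = s\<^sub>i \<bullet> w\<^sub>i \<noteq> 0\<close>, each update subtracts \<open>w\<^sub>i w\<^sub>i\<^sup>T / e\<^sub>i\<close>, so
  after \<open>m = k + 1\<close> updates \<open>B\<^sub>m = B\<^sub>0 - W E\<^sup>-\<^sup>1 W\<^sup>T\<close>. The columns of \<open>P = B\<^sub>0 S - Y\<close> are obtained
  from the \<open>w\<^sub>i\<close> by a triangular change of basis \<open>P = W U\<close> with unit diagonal. Hence
  \<open>B\<^sub>m = B\<^sub>0 - P K\<^sup>-\<^sup>1 P\<^sup>T\<close> with \<open>K = U\<^sup>T E U\<close>. This \<open>K\<close> is symmetric and agrees with \<open>S\<^sup>T P\<close> on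
  and below the diagonal, which forces \<open>K = S\<^sup>T B\<^sub>0 S - (L + D + L\<^sup>T)\<close>; this is lemma
  \<open>sr1_compact_form\<close>, and the last formula is read off in the theorem.

  The intermediate \<open>B\<^sub>i\<close> may be singular, so no recursion for their inverses is available. Only
  \<open>B\<^sub>0\<close> and \<open>B\<^sub>m\<close> are inverted, in a single application of the Sherman--Morrison--Woodbury identity
  (lemma \<open>woodbury\<close>), which also derives the invertibility of \<open>K - P\<^sup>T H\<^sub>0 P\<close> from that of \<open>B\<^sub>m\<close>.
  Since \<open>H\<^sub>0 P = S - H\<^sub>0 Y\<close>, expanding \<open>P\<^sup>T H\<^sub>0 P\<close> and cancelling against \<open>S\<^sup>T Y = L + D + R\<close> turns
  \<open>K - P\<^sup>T H\<^sub>0 P\<close> into \<open>D + R + R\<^sup>T - Y\<^sup>T H\<^sub>0 Y\<close>.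
\<close>

section \<open>Matrix algebra with dimension side conditions\<close>

text \<open>Stated with dimension equations in place of carrier sets, the laws have no variables that occur
  only in their premises, so the simplifier can use them to normalise products.\<close>

lemma mat_assoc:
  "dim_col A = dim_row B \<Longrightarrow> dim_col B = dim_row C \<Longrightarrow> A * B * C = A * (B * (C :: 'a :: comm_ring_1 mat))"
  by (rule assoc_mult_mat[of A "dim_row A" "dim_row B" B "dim_row C" C "dim_col C"]) (metis carrier_matI)+

lemma mat_distrib:
  fixes A :: "'a :: comm_ring_1 mat"
  shows "dim_col A = dim_row B \<Longrightarrow> dim_row B = dim_row C \<Longrightarrow> dim_col B = dim_col C \<Longrightarrow>
      A * (B + C) = A * B + A * C"
    "dim_col A = dim_row B \<Longrightarrow> dim_row B = dim_row C \<Longrightarrow> dim_col B = dim_col C \<Longrightarrow>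
      A * (B - C) = A * B - A * C"
    "dim_col B = dim_row A \<Longrightarrow> dim_row B = dim_row C \<Longrightarrow> dim_col B = dim_col C \<Longrightarrow>
      (B + C) * A = B * A + C * A"
    "dim_col B = dim_row A \<Longrightarrow> dim_row B = dim_row C \<Longrightarrow> dim_col B = dim_col C \<Longrightarrow>
      (B - C) * A = B * A - C * A"
  subgoal by (rule mult_add_distrib_mat[of A "dim_row A" "dim_row B" B "dim_col B" C]) (metis carrier_matI)+
  subgoal by (rule mult_minus_distrib_mat[of A "dim_row A" "dim_row B" B "dim_col B" C]) (metis carrier_matI)+
  subgoal by (rule add_mult_distrib_mat[of B "dim_row B" "dim_col B" C A "dim_col A"]) (metis carrier_matI)+
  subgoal by (rule minus_mult_distrib_mat[of B "dim_row B" "dim_col B" C A "dim_col A"]) (metis carrier_matI)+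
  done

lemma mat_cancel_left:
  fixes A :: "'a :: comm_ring_1 mat"
  assumes "A * B = 1\<^sub>m n" "dim_col A = dim_row B" "dim_col B = n" "dim_row X = n"
  shows "A * (B * X) = X"
  using assms mat_assoc[of A B X] by simp

lemma mat_transpose_mult:
  fixes A :: "'a :: comm_ring_1 mat"
  assumes "dim_col A = dim_row B"
  shows "transpose_mat (A * B) = transpose_mat B * transpose_mat A"
  using assms by (intro transpose_mult[of A "dim_row A" "dim_row B" B "dim_col B"]) (metis carrier_matI)+

lemma index_mult_mat_sum:
  fixes A :: "'a :: comm_ring_1 mat"
  assumes "i < dim_row A" "j < dim_col B" "dim_row B = m" "dim_col A = m"
  shows "(A * B) $$ (i, j) = (\<Sum>l<m. A $$ (i, l) * B $$ (l, j))"
  using assms by (simp add: scalar_prod_def atLeast0LessThan)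

lemma index_diag_mult:
  fixes A :: "'a :: comm_ring_1 mat"
  assumes D: "D = mat m m (\<lambda>(i, j). if i = j then d i else 0)" and "dim_row A = m" "i < m" "j < dim_col A"
  shows "(D * A) $$ (i, j) = d i * A $$ (i, j)"
proof -
  have "(D * A) $$ (i, j) = (\<Sum>l<m. D $$ (i, l) * A $$ (l, j))"
    using assms by (intro index_mult_mat_sum) auto
  also have "\<dots> = (\<Sum>l<m. if l = i then d i * A $$ (i, j) else 0)"
    using assms by (intro sum.cong) auto
  finally show ?thesis using assms by simp
qed

lemma index_mult_diag:
  fixes A :: "'a :: comm_ring_1 mat"
  assumes D: "D = mat m m (\<lambda>(i, j). if i = j then d i else 0)" and "dim_col A = m" "i < dim_row A" "j < m"
  shows "(A * D) $$ (i, j) = A $$ (i, j) * d j"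
proof -
  have "(A * D) $$ (i, j) = (\<Sum>l<m. A $$ (i, l) * D $$ (l, j))"
    using assms by (intro index_mult_mat_sum) auto
  also have "\<dots> = (\<Sum>l<m. if l = j then A $$ (i, j) * d j else 0)"
    using assms by (intro sum.cong) auto
  finally show ?thesis using assms by simp
qed

section \<open>The Sherman--Morrison--Woodbury identity\<close>

text \<open>Everything follows from the resolvent identity \<open>H P J Q H' = H' - H\<close>. It gives
  \<open>N J Q H' = Q H\<close> for \<open>N = K - Q H P\<close>; so \<open>J + J Q H' P J\<close> is a right inverse of \<open>N\<close>, and
  \<open>J Q H' = N\<^sup>-\<^sup>1 Q H\<close>, which put back into the resolvent identity is the claim.\<close>

lemma woodbury:
  fixes A :: "'a :: field mat"
  assumes car: "A \<in> carrier_mat n n" "H \<in> carrier_mat n n" "A' \<in> carrier_mat n n" "H' \<in> carrier_mat n n"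
      "P \<in> carrier_mat n m" "Q \<in> carrier_mat m n" "K \<in> carrier_mat m m" "J \<in> carrier_mat m m"
    and H: "H * A = 1\<^sub>m n" and H': "A' * H' = 1\<^sub>m n" and J: "K * J = 1\<^sub>m m"
    and A': "A' = A - P * J * Q"
  shows "invertible_mat (K - Q * H * P)"
    and "H' = H + H * P * mat_inv (K - Q * H * P) * Q * H"
proof -
  define N where "N = K - Q * H * P"
  have dims [simp]: "dim_row A = n" "dim_col A = n" "dim_row H = n" "dim_col H = n"
    "dim_row A' = n" "dim_col A' = n" "dim_row H' = n" "dim_col H' = n" "dim_row P = n" "dim_col P = m"
    "dim_row Q = m" "dim_col Q = n" "dim_row K = m" "dim_col K = m" "dim_row J = m" "dim_col J = m"
    using car by auto
  have N: "N \<in> carrier_mat m m" by (auto simp: N_def)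
  have dimsN [simp]: "dim_row N = m" "dim_col N = m" using N by auto
  have resolvent: "H * (P * (J * (Q * H'))) = H' - H"
  proof -
    have "H * (A' * H') = H' - H * (P * (J * (Q * H')))"
      unfolding A' by (simp add: mat_assoc mat_distrib mat_cancel_left[OF H])
    then have "H = H' - H * (P * (J * (Q * H')))"
      by (simp add: H' right_mult_one_mat[OF car(2)])
    then have "H $$ (i, j) = H' $$ (i, j) - (H * (P * (J * (Q * H')))) $$ (i, j)"
      if "i < n" "j < n" for i j
      using that index_minus_mat(1)[of i "H * (P * (J * (Q * H')))" j H'] by simp
    then show ?thesis by (intro eq_matI) (auto simp del: index_mult_mat(1))
  qed
  have key: "N * (J * (Q * H')) = Q * H"
  proof -
    have "N * (J * (Q * H')) = Q * H' - Q * (H' - H)"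
      unfolding N_def
      by (simp add: mat_assoc mat_distrib mat_cancel_left[OF J] resolvent)
    then show ?thesis by (auto simp: mat_distrib simp del: index_mult_mat(1))
  qed
  have "N * (J + J * (Q * (H' * (P * J)))) = 1\<^sub>m m"
  proof -
    have "N * (J + J * (Q * (H' * (P * J)))) = N * J + (N * (J * (Q * H'))) * (P * J)"
      by (simp add: mat_assoc mat_distrib)
    also have "\<dots> = (1\<^sub>m m - Q * (H * (P * J))) + Q * (H * (P * J))"
      unfolding key by (simp add: N_def mat_assoc mat_distrib J)
    also have "\<dots> = 1\<^sub>m m"
      by (intro eq_matI) (auto simp del: index_mult_mat(1))
    finally show ?thesis .
  qed
  moreover have X: "J + J * (Q * (H' * (P * J))) \<in> carrier_mat m m" by (rule carrier_matI) auto
  ultimately have "invertible_mat N"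
    using mat_mult_left_right_inverse[OF N X]
    unfolding invertible_mat_def inverts_mat_def
    by (intro conjI exI[of _ "J + J * (Q * (H' * (P * J)))"]) auto
  then show "invertible_mat (K - Q * H * P)" by (simp add: N_def)
  note Ni = mat_inv[OF N \<open>invertible_mat N\<close>]
  have [simp]: "dim_row (mat_inv N) = m" "dim_col (mat_inv N) = m" using Ni(1) by auto
  have "J * (Q * H') = mat_inv N * (N * (J * (Q * H')))"
    by (simp add: mat_cancel_left[OF Ni(3)])
  then have "H' - H = H * (P * (mat_inv N * (Q * H)))"
    using resolvent by (simp add: key)
  then have "H' $$ (i, j) - H $$ (i, j) = (H * (P * (mat_inv N * (Q * H)))) $$ (i, j)"
    if "i < n" "j < n" for i j
    using that index_minus_mat(1)[of i H j H'] by simp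
  then have "H' = H + H * (P * (mat_inv N * (Q * H)))"
    by (intro eq_matI) (auto simp: algebra_simps simp del: index_mult_mat(1))
  then show "H' = H + H * P * mat_inv (K - Q * H * P) * Q * H"
    unfolding N_def[symmetric] by (simp add: mat_assoc)
qed

section \<open>Compact form of a sequence of SR1 updates\<close>

text \<open>The witnesses are \<open>K = U\<^sup>T E U\<close> and its inverse \<open>J\<close>, where \<open>P = W U\<close> as explained above.
  On and below the diagonal \<open>K\<close> agrees with \<open>S\<^sup>T P = (S\<^sup>T W) U\<close> because \<open>U\<^sup>T E\<close> is exactly the lower
  triangle of \<open>S\<^sup>T W\<close>: the strictly upper triangular rest of \<open>S\<^sup>T W\<close> times \<open>U\<close> stays strictly upper
  triangular. Together with symmetry this determines \<open>K\<close>.\<close>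

lemma sr1_compact_form:
  fixes B :: "nat \<Rightarrow> 'a :: field mat"
  assumes B0: "B 0 \<in> carrier_mat n n"
    and s: "\<And>i. i < m \<Longrightarrow> s i \<in> carrier_vec n" and y: "\<And>i. i < m \<Longrightarrow> y i \<in> carrier_vec n"
    and wd: "\<And>i. i < m \<Longrightarrow> sr1_well_defined (B i) (s i) (y i)"
    and upd: "\<And>i. i < m \<Longrightarrow> B (i + 1) = sr1_update (B i) (s i) (y i)"
    and S: "S = mat_of_cols n (map s [0..<m])" and Y: "Y = mat_of_cols n (map y [0..<m])"
    and P: "P = B 0 * S - Y"
  obtains K J where "K \<in> carrier_mat m m" "J \<in> carrier_mat m m" "transpose_mat K = K" "K * J = 1\<^sub>m m"
    "B m = B 0 - P * J * transpose_mat P"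
    "\<And>i j. i < m \<Longrightarrow> j \<le> i \<Longrightarrow> K $$ (i, j) = (transpose_mat S * P) $$ (i, j)"
proof -
  define w where "w i = B i *\<^sub>v s i - y i" for i
  define e where "e i = s i \<bullet> w i" for i
  have B: "B i \<in> carrier_mat n n" if "i \<le> m" for i
    using that
  proof (induction i)
    case (Suc i)
    then show ?case using upd[of i] y[of i] by (auto simp: sr1_update_def outer_prod_def)
  qed (use B0 in simp)
  have w: "w i \<in> carrier_vec n" if "i < m" for i
    using that B[of i] s[of i] y[of i] by (auto simp: w_def)
  have neg: "y i - B i *\<^sub>v s i = - w i" if "i < m" for i
    using that B[of i] s[of i] y[of i] by (auto simp: w_def)
  have sneg: "s i \<bullet> - w i = - e i" if "i < m" for i
    using w[OF that] s[OF that] by (simp add: e_def)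
  have e: "e i \<noteq> 0" if "i < m" for i
    using wd[OF that] sneg[OF that] neg[OF that] by (simp add: sr1_well_defined_def)
  have B_entry: "B i $$ (a, b) = B 0 $$ (a, b) - (\<Sum>l<i. w l $ a * w l $ b / e l)"
    if "i \<le> m" "a < n" "b < n" for i a b
    using that
  proof (induction i)
    case (Suc i)
    then have "i < m" by simp
    with Suc w[of i] B[of i] show ?case
      by (simp add: upd[of i, simplified] sr1_update_def neg sneg outer_prod_def)
  qed simp
  (* Expand B_j s_j in w_j = B_j s_j - y_j. The summand l = j is w_j itself, as w_j . s_j = e_j. *)
  have P_col: "P $$ (a, j) = (\<Sum>l\<le>j. w l $ a * ((w l \<bullet> s j) / e l))"
    if a: "a < n" and j: "j < m" for a j
  proof -
    have "w j $ a = (\<Sum>b<n. B j $$ (a, b) * s j $ b) - y j $ a"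
      using a j B[of j] s[of j] y[of j]
      by (simp add: w_def scalar_prod_def atLeast0LessThan)
    also have "(\<Sum>b<n. B j $$ (a, b) * s j $ b) = (\<Sum>b<n. B 0 $$ (a, b) * s j $ b) -
        (\<Sum>b<n. \<Sum>l<j. w l $ a * w l $ b / e l * s j $ b)"
      using a j by (simp add: B_entry[of j a] left_diff_distrib sum_subtractf sum_distrib_right)
    also have "(\<Sum>b<n. \<Sum>l<j. w l $ a * w l $ b / e l * s j $ b) = (\<Sum>l<j. w l $ a * ((w l \<bullet> s j) / e l))"
      using s[OF j] by (subst sum.swap)
        (simp add: scalar_prod_def atLeast0LessThan sum_distrib_left sum_divide_distrib mult.assoc)
    finally have "(\<Sum>b<n. B 0 $$ (a, b) * s j $ b) - y j $ a =
        w j $ a + (\<Sum>l<j. w l $ a * ((w l \<bullet> s j) / e l))"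
      by simp
    moreover have "P $$ (a, j) = (\<Sum>b<n. B 0 $$ (a, b) * s j $ b) - y j $ a"
      using a j B0 s[OF j] y[OF j] by (simp add: P S Y scalar_prod_def atLeast0LessThan mat_of_cols_index)
    moreover have "(w j \<bullet> s j) / e j = 1"
      using e[OF j] comm_scalar_prod[OF w[OF j] s[OF j]] by (simp add: e_def)
    ultimately show ?thesis
      by (simp add: lessThan_Suc_atMost[symmetric])
  qed
  define W where "W = mat n m (\<lambda>(a, i). w i $ a)"
  define E where "E = mat m m (\<lambda>(i, j). if i = j then e i else 0)"
  define F where "F = mat m m (\<lambda>(i, j). if i = j then 1 / e i else 0)"
  define U where "U = mat m m (\<lambda>(i, j). if i \<le> j then (w i \<bullet> s j) / e i else 0)"
  have dims [simp]: "dim_row W = n" "dim_col W = m" "dim_row E = m" "dim_col E = m" "dim_row F = m"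
    "dim_col F = m" "dim_row U = m" "dim_col U = m" "dim_row S = n" "dim_col S = m" "dim_row P = n" "dim_col P = m"
    "dim_row (B 0) = n" "dim_col (B 0) = n" "dim_row (B m) = n" "dim_col (B m) = n"
    using B0 B[of m] by (auto simp: W_def E_def F_def U_def S Y P)
  have PWU: "P = W * U"
  proof (rule eq_matI)
    fix a j assume "a < dim_row (W * U)" "j < dim_col (W * U)"
    then have aj: "a < n" "j < m" by auto
    have "(W * U) $$ (a, j) = (\<Sum>l<m. w l $ a * (if l \<le> j then (w l \<bullet> s j) / e l else 0))"
      using aj by (simp add: W_def U_def scalar_prod_def atLeast0LessThan)
    also have "\<dots> = (\<Sum>l\<le>j. w l $ a * ((w l \<bullet> s j) / e l))"
      using aj by (intro sum.mono_neutral_cong_right) auto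
    finally show "P $$ (a, j) = (W * U) $$ (a, j)" using P_col[OF aj] by simp
  qed auto
  have EF: "E * F = 1\<^sub>m m"
  proof (rule eq_matI)
    fix i j assume "i < dim_row (1\<^sub>m m)" "j < dim_col (1\<^sub>m m)"
    then have ij: "i < m" "j < m" by auto
    then show "(E * F) $$ (i, j) = 1\<^sub>m m $$ (i, j)"
      using e[of i] by (auto simp: index_diag_mult[OF E_def] F_def simp del: index_mult_mat(1))
  qed auto
  have Uc: "U \<in> carrier_mat m m" by (rule carrier_matI) simp_all
  have "U $$ (i, i) = 1" if "i < m" for i
    using that e[OF that] comm_scalar_prod[OF w[OF that] s[OF that]] by (simp add: U_def e_def)
  then have "prod_list (diag_mat U) = 1"
    by (simp add: prod_list_diag_prod)
  moreover have "upper_triangular U" by (auto simp: U_def)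
  ultimately have "det U = 1" using det_upper_triangular[OF _ Uc] by metis
  then have "U \<in> Units (ring_mat TYPE('a) m ())"
    by (intro det_non_zero_imp_unit[OF Uc]) simp
  then obtain V where V: "V \<in> carrier_mat m m" "U * V = 1\<^sub>m m" "V * U = 1\<^sub>m m"
    unfolding Units_def ring_mat_def by auto
  have [simp]: "dim_row V = m" "dim_col V = m" using V(1) by auto
  have UVt: "transpose_mat V * transpose_mat U = 1\<^sub>m m"
    using arg_cong[OF V(2), of transpose_mat] by (simp add: mat_transpose_mult)
  have VUt: "transpose_mat U * transpose_mat V = 1\<^sub>m m"
    using arg_cong[OF V(3), of transpose_mat] by (simp add: mat_transpose_mult)
  define K where "K = transpose_mat U * (E * U)"
  define J where "J = V * (F * transpose_mat V)"
  have [simp]: "transpose_mat E = E" by (rule eq_matI) (auto simp: E_def)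
  show thesis
  proof (rule that[of K J])
    show "K \<in> carrier_mat m m" "J \<in> carrier_mat m m" by (auto simp: K_def J_def)
    show "transpose_mat K = K" by (simp add: K_def mat_transpose_mult mat_assoc)
    show "K * J = 1\<^sub>m m"
      by (simp add: K_def J_def mat_assoc mat_cancel_left[OF V(2)] mat_cancel_left[OF EF] VUt)
    have "P * J * transpose_mat P = W * (F * transpose_mat W)"
      by (simp add: PWU J_def mat_transpose_mult mat_assoc mat_cancel_left[OF V(2)] mat_cancel_left[OF UVt])
    moreover have "B m = B 0 - W * (F * transpose_mat W)"
    proof (rule eq_matI)
      fix a b assume "a < dim_row (B 0 - W * (F * transpose_mat W))"
        "b < dim_col (B 0 - W * (F * transpose_mat W))"
      then have ab: "a < n" "b < n" by auto
      have "(W * (F * transpose_mat W)) $$ (a, b) =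
          (\<Sum>l<m. W $$ (a, l) * (F * transpose_mat W) $$ (l, b))"
        using ab by (intro index_mult_mat_sum) auto
      also have "\<dots> = (\<Sum>l<m. w l $ a * w l $ b / e l)"
        using ab by (intro sum.cong) (simp_all add: index_diag_mult[OF F_def] W_def del: index_mult_mat(1))
      finally show "B m $$ (a, b) = (B 0 - W * (F * transpose_mat W)) $$ (a, b)"
        using ab by (simp add: B_entry[of m a b] del: index_mult_mat(1))
    qed auto
    ultimately show "B m = B 0 - P * J * transpose_mat P" by simp
  next
    fix i j assume ij: "i < m" "j \<le> i"
    have SW: "(transpose_mat S * W) $$ (i, l) = s i \<bullet> w l" if "l < m" for l
      using that ij s[of i] w[of l] by (simp add: S W_def scalar_prod_def mat_of_cols_index)
    have UE: "(transpose_mat U * E) $$ (i, l) = (if l \<le> i then s i \<bullet> w l else 0)" if l: "l < m" for l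
      using l ij e[OF l] comm_scalar_prod[OF w[OF l] s[OF ij(1)]]
      by (simp add: index_mult_diag[OF E_def] U_def del: index_mult_mat(1))
    (* U(l,j) vanishes for l > j, and l <= j <= i is the range on which U^T E and S^T W agree. *)
    have "K $$ (i, j) = (transpose_mat U * E * U) $$ (i, j)" by (simp add: K_def mat_assoc)
    also have "\<dots> = (\<Sum>l<m. (transpose_mat U * E) $$ (i, l) * U $$ (l, j))"
      using ij by (intro index_mult_mat_sum) auto
    also have "\<dots> = (\<Sum>l<m. (transpose_mat S * W) $$ (i, l) * U $$ (l, j))"
    proof (intro sum.cong refl)
      fix l assume l: "l \<in> {..<m}"
      have "U $$ (l, j) = 0" if "j < l"
        using that l ij by (simp add: U_def)
      then show "(transpose_mat U * E) $$ (i, l) * U $$ (l, j) = (transpose_mat S * W) $$ (i, l) * U $$ (l, j)"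
        using l ij by (cases "l \<le> j") (simp_all add: UE SW del: index_mult_mat(1))
    qed
    also have "\<dots> = (transpose_mat S * W * U) $$ (i, j)"
      using ij by (intro index_mult_mat_sum[symmetric]) auto
    finally show "K $$ (i, j) = (transpose_mat S * P) $$ (i, j)" by (simp add: PWU mat_assoc)
  qed
qed

section \<open>The inverse of the final SR1 matrix\<close>

theorem mainTheorem3:
  fixes n k :: nat
    and s y :: "nat \<Rightarrow> real vec"
    and B :: "nat \<Rightarrow> real mat"
    and S Y L D R H0 \<Psi> :: "real mat"
  assumes B0: "B 0 \<in> carrier_mat n n" "transpose_mat (B 0) = B 0" "invertible_mat (B 0)"
    and pairs: "\<And>i. i \<le> k \<Longrightarrow> s i \<in> carrier_vec n" "\<And>i. i \<le> k \<Longrightarrow> y i \<in> carrier_vec n"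
    and well_defined: "\<And>i. i \<le> k \<Longrightarrow> sr1_well_defined (B i) (s i) (y i)"
    and update: "\<And>i. i \<le> k \<Longrightarrow> B (i + 1) = sr1_update (B i) (s i) (y i)"
    and nonsingular: "invertible_mat (B (k + 1))"
    and S: "S = mat_of_cols n (map s [0..<k + 1])"
    and Y: "Y = mat_of_cols n (map y [0..<k + 1])"
    and carrier_LDR: "L \<in> carrier_mat (k + 1) (k + 1)" "D \<in> carrier_mat (k + 1) (k + 1)"
      "R \<in> carrier_mat (k + 1) (k + 1)"
    and decomposition: "transpose_mat S * Y = L + D + R"
    and shape: "strictly_lower_triangular L" "diagonal_mat D" "strictly_upper_triangular R"
    and H0: "H0 = mat_inv (B 0)"
    and \<Psi>: "\<Psi> = S - H0 * Y"
  shows "invertible_mat (D + R + transpose_mat R - transpose_mat Y * H0 * Y) \<and>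
    mat_inv (B (k + 1)) =
      H0 + \<Psi> * mat_inv (D + R + transpose_mat R - transpose_mat Y * H0 * Y) * transpose_mat \<Psi>"
proof -
  define m where "m = k + 1"
  define P where "P = B 0 * S - Y"
  have dims [simp]: "dim_row S = n" "dim_col S = m" "dim_row Y = n" "dim_col Y = m"
    "dim_row (B 0) = n" "dim_col (B 0) = n" "dim_row L = m" "dim_col L = m" "dim_row D = m" "dim_col D = m"
    "dim_row R = m" "dim_col R = m" "dim_row P = n" "dim_col P = m"
    using B0 carrier_LDR by (auto simp: S Y m_def P_def)
  obtain K J where KJ: "K \<in> carrier_mat m m" "J \<in> carrier_mat m m" "transpose_mat K = K" "K * J = 1\<^sub>m m"
    "B m = B 0 - P * J * transpose_mat P"
    and K_lower: "\<And>i j. i < m \<Longrightarrow> j \<le> i \<Longrightarrow> K $$ (i, j) = (transpose_mat S * P) $$ (i, j)"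
  proof (rule sr1_compact_form[of B n m s y S Y P])
    show "S = mat_of_cols n (map s [0..<m])" "Y = mat_of_cols n (map y [0..<m])"
      unfolding m_def by (fact S, fact Y)
  qed (use B0 pairs well_defined update in \<open>auto simp: P_def m_def\<close>)
  have [simp]: "dim_row K = m" "dim_col K = m" using KJ by auto
  note H = mat_inv[OF B0(1,3), folded H0]
  have Bm: "B m \<in> carrier_mat n n" using KJ(5) by auto
  note H' = mat_inv[OF Bm nonsingular[folded m_def]]
  have [simp]: "dim_row H0 = n" "dim_col H0 = n" using H by auto
  have HT: "transpose_mat H0 = H0"
  proof -
    have "transpose_mat H0 * B 0 = 1\<^sub>m n"
      using arg_cong[OF H(2), of transpose_mat] by (simp add: mat_transpose_mult B0)
    then have "transpose_mat H0 * (B 0 * H0) = H0" by (simp add: mat_cancel_left)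
    then show ?thesis using H(1) by (simp add: H(2) right_mult_one_mat[of _ n n])
  qed
  have HP: "H0 * P = \<Psi>"
    by (simp add: P_def \<Psi> mat_distrib mat_cancel_left[OF H(3)])
  have PH: "transpose_mat P * H0 = transpose_mat \<Psi>"
    using arg_cong[OF HP, of transpose_mat] by (simp add: mat_transpose_mult HT)
  define G where "G = transpose_mat S * (B 0 * S)"
  have [simp]: "dim_row G = m" "dim_col G = m" by (auto simp: G_def)
  have G_sym: "G $$ (j, i) = G $$ (i, j)" if "i < m" "j < m" for i j
  proof -
    have "transpose_mat G = G" by (simp add: G_def mat_transpose_mult B0 mat_assoc)
    then show ?thesis using that by (metis index_transpose_mat(1) \<open>dim_row G = m\<close> \<open>dim_col G = m\<close>)
  qed
  have SY: "(transpose_mat S * Y) $$ (i, j) = L $$ (i, j) + D $$ (i, j) + R $$ (i, j)"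
    if "i < m" "j < m" for i j
    using that by (simp add: decomposition del: index_mult_mat(1))
  (* On and below the diagonal R vanishes, so S^T P = S^T B_0 S - S^T Y contributes only L + D there; the
     upper triangle follows by symmetry, which is where the entry of L^T comes from. *)
  have K_entry: "K $$ (i, j) = G $$ (i, j) - (L $$ (i, j) + D $$ (i, j) + L $$ (j, i))"
    if ij: "i < m" "j < m" for i j
  proof -
    have lower: "K $$ (i, j) = G $$ (i, j) - (L $$ (i, j) + D $$ (i, j))" if "i < m" "j \<le> i" for i j
    proof -
      have "transpose_mat S * P = G - transpose_mat S * Y"
        by (simp add: P_def G_def mat_distrib)
      moreover have "R $$ (i, j) = 0"
        using that shape(3) by (auto simp: strictly_upper_triangular_def)
      ultimately show ?thesis
        using K_lower[OF that] that SY[of i j] by (simp del: index_mult_mat(1))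
    qed
    have D: "D $$ (i, j) = D $$ (j, i)"
      using shape(2) ij by (cases "i = j") (auto simp: diagonal_mat_def)
    have L0: "L $$ (i, j) = 0" if "i \<le> j" "i < m" "j < m" for i j
      using that shape(1) by (auto simp: strictly_lower_triangular_def)
    have "K $$ (i, j) = K $$ (j, i)"
      using arg_cong[OF KJ(3), of "\<lambda>X. X $$ (i, j)"] ij by simp
    then show ?thesis
      using lower[of i j] lower[of j i] L0[of i j] L0[of j i] G_sym[OF ij] D ij by (cases "j \<le> i") auto
  qed
  have N: "K - transpose_mat P * H0 * P = D + R + transpose_mat R - transpose_mat Y * H0 * Y"
  proof (rule eq_matI)
    fix i j assume "i < dim_row (D + R + transpose_mat R - transpose_mat Y * H0 * Y)"
      "j < dim_col (D + R + transpose_mat R - transpose_mat Y * H0 * Y)"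
    then have ij: "i < m" "j < m" by auto
    have "transpose_mat P * H0 * P = transpose_mat \<Psi> * P" by (simp add: PH)
    also have "transpose_mat \<Psi> = transpose_mat S - transpose_mat (H0 * Y)"
      unfolding \<Psi> by (intro eq_matI) (auto simp del: index_mult_mat(1))
    also have "\<dots> * P = (G - transpose_mat Y * S) - (transpose_mat S * Y - transpose_mat Y * H0 * Y)"
      by (simp add: P_def G_def mat_transpose_mult HT mat_distrib mat_assoc mat_cancel_left[OF H(3)])
    finally have PHP: "transpose_mat P * H0 * P =
      (G - transpose_mat Y * S) - (transpose_mat S * Y - transpose_mat Y * H0 * Y)" .
    have YS: "(transpose_mat Y * S) $$ (i, j) = (transpose_mat S * Y) $$ (j, i)"
      using arg_cong[OF mat_transpose_mult[of "transpose_mat S" Y], of "\<lambda>X. X $$ (i, j)"] ij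
      by (simp del: index_mult_mat(1))
    have D: "D $$ (i, j) = D $$ (j, i)"
      using shape(2) ij by (cases "i = j") (auto simp: diagonal_mat_def)
    show "(K - transpose_mat P * H0 * P) $$ (i, j) =
      (D + R + transpose_mat R - transpose_mat Y * H0 * Y) $$ (i, j)"
      unfolding PHP using ij by (simp add: YS SY K_entry D del: index_mult_mat(1))
  qed auto
  have "P \<in> carrier_mat n m" "transpose_mat P \<in> carrier_mat m n" by auto
  note wb = woodbury[OF B0(1) H(1) Bm H'(1) this KJ(1,2) H(3) H'(2) KJ(4,5)]
  have inv: "invertible_mat (D + R + transpose_mat R - transpose_mat Y * H0 * Y)"
    using wb(1) by (simp only: N)
  have "D + R + transpose_mat R - transpose_mat Y * H0 * Y \<in> carrier_mat m m" by auto
  from mat_inv(1)[OF this inv]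
  have "mat_inv (B m) = H0 + \<Psi> * mat_inv (D + R + transpose_mat R - transpose_mat Y * H0 * Y) * (transpose_mat P * H0)"
    using wb(2) unfolding N HP by (subst mat_assoc[symmetric]) auto
  with inv show ?thesis by (simp add: m_def PH)
qed

end
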